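(* Let $\alpha$ be a Frenet curve in $E^3$ with Frenet frame $\{T,N,B\}$, curvature $\kappa$ and torsion $\tau$, and let $\beta$ be an evolute-direction curve of $\alpha$ with curvature $\overline\kappa$ and torsion $\overline\tau$. Let $\int\tau\,ds$ denote the antiderivative of $\tau$ (determined modulo $2\pi$) for which $\beta'=\sin\left(\int\tau\,ds\right)N+\cos\left(\int\tau\,ds\right)B$. Then $$\overline\kappa=\kappa\left|\sin\left(\int\tau\,ds\right)\right|,\qquad \overline\tau=\kappa\cos\left(\int\tau\,ds\right),$$ $$\kappa=\sqrt{\overline\kappa^2+\overline\tau^2},\qquad \tau=\frac{\overline\kappa^2}{\overline\kappa^2+\overline\tau^2}\left(\frac{\overline\tau}{\overline\kappa}\right)'.$$
   Context: $I\subset\mathbb{R}$ is an open interval and curves are smooth. A unit speed curve $\alpha:I\to E^3$ is a Frenet curve if its curvature $\kappa=\|\alpha''\|$ is nowhere zero; then $T=\alpha'$, $N=\alpha''/\kappa$, $B=T\times N$, and $T'=\kappa N$, $N'=-\kappa T+\tau B$, $B'=-\tau N$, where $\tau$ is the torsion. For a unit vector field $X(s)=a(s)T(s)+b(s)N(s)+c(s)B(s)$ with $a,b,c$ smooth and $a^2+b^2+c^2=1$, an $X$-direction curve of $\alpha$ is a curve $\beta:I\to E^3$ with $\beta'(s)=X(s)$; the parameter $s$ is then also arc length for $\beta$. The Frenet apparatus of $\beta$ is defined in the same way and denoted $\{\overline T,\overline N,\overline B\},\overline\kappa,\overline\tau$. An $X$-direction curve $\beta$ of $\alpha$ (for some such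 $X$) is called an evolute-direction curve of $\alpha$ if it is an evolute of $\alpha$, in the sense that $\beta$ is a Frenet curve with $\langle\overline T,T\rangle=0$ and $\overline N=T$ at each common parameter value $s$. In that case $\beta'=\sin\left(\int\tau\,ds\right)N+\cos\left(\int\tau\,ds\right)B$ for some antiderivative of $\tau$. Primes denote $d/ds$. *)

theory Defs
  imports "HOL-Analysis.Analysis"
begin

text \<open>Curves are total functions on the reals of which only the values on an open interval
  \<open>I\<close> matter. As \<open>I\<close> is open, derivatives at points of \<open>I\<close> do not depend on values outside it.\<close>

definition curve_deriv :: "(real \<Rightarrow> 'a::real_normed_vector) \<Rightarrow> real \<Rightarrow> 'a" where
  "curve_deriv f s = vector_derivative f (at s)"

definition smooth_on :: "real set \<Rightarrow> (real \<Rightarrow> 'a::real_normed_vector) \<Rightarrow> bool" where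
  "smooth_on I f \<longleftrightarrow> (\<forall>n. \<forall>s\<in>I. (curve_deriv ^^ n) f differentiable (at s))"

definition tangent :: "(real \<Rightarrow> real^3) \<Rightarrow> real \<Rightarrow> real^3" where
  "tangent \<alpha> = curve_deriv \<alpha>"

definition curvature :: "(real \<Rightarrow> real^3) \<Rightarrow> real \<Rightarrow> real" where
  "curvature \<alpha> s = norm (curve_deriv (curve_deriv \<alpha>) s)"

definition normal :: "(real \<Rightarrow> real^3) \<Rightarrow> real \<Rightarrow> real^3" where
  "normal \<alpha> s = curve_deriv (curve_deriv \<alpha>) s /\<^sub>R curvature \<alpha> s"

definition binormal :: "(real \<Rightarrow> real^3) \<Rightarrow> real \<Rightarrow> real^3" where
  "binormal \<alpha> s = cross3 (tangent \<alpha> s) (normal \<alpha> s)"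

text \<open>The sign convention is that of the Frenet equation \<open>B' = - \<tau> N\<close>; the torsion is
  read off from it by taking the inner product with the unit vector \<open>N\<close>.\<close>

definition torsion :: "(real \<Rightarrow> real^3) \<Rightarrow> real \<Rightarrow> real" where
  "torsion \<alpha> s = - (curve_deriv (binormal \<alpha>) s \<bullet> normal \<alpha> s)"

definition frenet_curve :: "real set \<Rightarrow> (real \<Rightarrow> real^3) \<Rightarrow> bool" where
  "frenet_curve I \<alpha> \<longleftrightarrow>
     smooth_on I \<alpha> \<and> (\<forall>s\<in>I. norm (curve_deriv \<alpha> s) = 1) \<and> (\<forall>s\<in>I. curvature \<alpha> s \<noteq> 0)"

definition unit_frame_field ::
    "real set \<Rightarrow> (real \<Rightarrow> real^3) \<Rightarrow> (real \<Rightarrow> real^3) \<Rightarrow> bool" where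
  "unit_frame_field I \<alpha> X \<longleftrightarrow>
     (\<exists>a b c :: real \<Rightarrow> real. smooth_on I a \<and> smooth_on I b \<and> smooth_on I c \<and>
        (\<forall>s\<in>I. (a s)\<^sup>2 + (b s)\<^sup>2 + (c s)\<^sup>2 = 1 \<and>
           X s = a s *\<^sub>R tangent \<alpha> s + b s *\<^sub>R normal \<alpha> s + c s *\<^sub>R binormal \<alpha> s))"

definition direction_curve ::
    "real set \<Rightarrow> (real \<Rightarrow> real^3) \<Rightarrow> (real \<Rightarrow> real^3) \<Rightarrow> (real \<Rightarrow> real^3) \<Rightarrow> bool" where
  "direction_curve I \<alpha> X \<beta> \<longleftrightarrow>
     unit_frame_field I \<alpha> X \<and> (\<forall>s\<in>I. (\<beta> has_vector_derivative X s) (at s))"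

definition evolute :: "real set \<Rightarrow> (real \<Rightarrow> real^3) \<Rightarrow> (real \<Rightarrow> real^3) \<Rightarrow> bool" where
  "evolute I \<alpha> \<beta> \<longleftrightarrow>
     frenet_curve I \<beta> \<and>
     (\<forall>s\<in>I. tangent \<beta> s \<bullet> tangent \<alpha> s = 0 \<and> normal \<beta> s = tangent \<alpha> s)"

definition evolute_direction_curve ::
    "real set \<Rightarrow> (real \<Rightarrow> real^3) \<Rightarrow> (real \<Rightarrow> real^3) \<Rightarrow> bool" where
  "evolute_direction_curve I \<alpha> \<beta> \<longleftrightarrow> (\<exists>X. direction_curve I \<alpha> X \<beta>) \<and> evolute I \<alpha> \<beta>"

text \<open>\<open>\<theta>\<close> is the antiderivative of the torsion of \<open>\<alpha>\<close> for which
  \<open>\<beta>' = sin \<theta> N + cos \<theta> B\<close>; it is determined up to an integer multiple of \<open>2 \<pi>\<close>.\<close>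

definition evolute_angle ::
    "real set \<Rightarrow> (real \<Rightarrow> real^3) \<Rightarrow> (real \<Rightarrow> real^3) \<Rightarrow> (real \<Rightarrow> real) \<Rightarrow> bool" where
  "evolute_angle I \<alpha> \<beta> \<theta> \<longleftrightarrow>
     (\<forall>s\<in>I. (\<theta> has_real_derivative torsion \<alpha> s) (at s) \<and>
        curve_deriv \<beta> s = sin (\<theta> s) *\<^sub>R normal \<alpha> s + cos (\<theta> s) *\<^sub>R binormal \<alpha> s)"

end

theory Submission imports Defs begin

text \<open>
  Write \<open>T, N, B\<close> for the frame of \<open>\<alpha>\<close> and let \<open>b = \<beta>' \<bullet> N\<close>, \<open>c = \<beta>' \<bullet> B\<close>. The evolute conditions
  say \<open>\<beta>' \<bottom> T\<close> and \<open>\<beta>'' = \<kappa>\<^sub>\<beta> T\<close>, where \<open>\<kappa>\<^sub>\<beta>, \<tau>\<^sub>\<beta>\<close> belong to \<open>\<beta>\<close> and \<open>\<kappa>, \<tau>\<close> to \<open>\<alpha>\<close>. Because \<open>\<beta>''\<close> is orthogonal to \<open>N\<close> and \<open>B\<close>, only the Frenet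
  equations of \<open>\<alpha>\<close> contribute to \<open>b'\<close> and \<open>c'\<close>: the point \<open>(b, c)\<close> moves on the unit circle with
  angular velocity \<open>\<tau>\<close>, that is, \<open>b' = \<tau> c\<close> and \<open>c' = - \<tau> b\<close>. Differentiating the two identities
  \<open>\<beta>' \<bullet> T = 0\<close> and \<open>binormal \<beta> = \<beta>' \<times> T\<close> yields \<open>\<kappa>\<^sub>\<beta> = - \<kappa> b\<close> and \<open>\<tau>\<^sub>\<beta> = \<kappa> c\<close>
  (lemma \<open>evolute_coefficients\<close>).

  Everything else is read off from these four equations. As \<open>\<kappa>\<close> and \<open>\<kappa>\<^sub>\<beta>\<close> are positive, \<open>b < 0\<close>, so
  \<open>(b, c)\<close> stays on one open half of the circle and has the explicit angle \<open>- arccos c\<close>,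
  whose derivative is \<open>\<tau>\<close> by the equation for \<open>c'\<close>. The squares of \<open>\<kappa>\<^sub>\<beta>\<close> and \<open>\<tau>\<^sub>\<beta>\<close> add up
  to \<open>\<kappa>\<^sup>2\<close>, and \<open>\<tau>\<^sub>\<beta> / \<kappa>\<^sub>\<beta> = - c / b\<close> has derivative \<open>\<tau> / b\<^sup>2\<close>, where \<open>b\<^sup>2\<close> is the factor
  \<open>\<kappa>\<^sub>\<beta>\<^sup>2 / (\<kappa>\<^sub>\<beta>\<^sup>2 + \<tau>\<^sub>\<beta>\<^sup>2)\<close>.
\<close>

section \<open>Derivatives and orthonormal frames in space\<close>

lemma smooth_on_has_curve_deriv:
  assumes "smooth_on I f" "s \<in> I"
  shows "((curve_deriv ^^ n) f has_vector_derivative (curve_deriv ^^ Suc n) f s) (at s)"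
  using assms by (simp add: smooth_on_def curve_deriv_def vector_derivative_works)

text \<open>The product rule for an inner product that is constant along the curve. This is how all
  components of the derivatives of an orthonormal frame are found.\<close>

lemma constant_inner_product_rule:
  fixes u v :: "real \<Rightarrow> 'a::real_inner"
  assumes "open I" "s \<in> I" and const: "\<And>t. t \<in> I \<Longrightarrow> u t \<bullet> v t = k"
    and u: "(u has_vector_derivative u') (at s)" and v: "(v has_vector_derivative v') (at s)"
  shows "u' \<bullet> v s + u s \<bullet> v' = 0"
proof -
  have "((\<lambda>t. u t \<bullet> v t) has_vector_derivative u s \<bullet> v' + u' \<bullet> v s) (at s)"
    by (rule bounded_bilinear.has_vector_derivative[OF bounded_bilinear_inner u v])
  then have "((\<lambda>t. k) has_vector_derivative u s \<bullet> v' + u' \<bullet> v s) (at s)"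
    by (rule has_vector_derivative_transform_within_open[OF _ assms(1,2)]) (rule const)
  then show ?thesis
    using vector_derivative_unique_at[OF _ has_vector_derivative_const] by fastforce
qed

text \<open>Lagrange's identity gives \<open>v - (v \<bullet> b) b = b \<times> (v \<times> b)\<close> for the unit vector \<open>b = t \<times> n\<close>, and the
  inner factor \<open>v \<times> (t \<times> n)\<close> expands by the same identity in \<open>t\<close> and \<open>n\<close>.\<close>

lemma orthonormal_pair_expansion:
  fixes t n v :: "real^3"
  assumes "t \<bullet> t = 1" "n \<bullet> n = 1" "t \<bullet> n = 0"
  shows "v = (v \<bullet> t) *\<^sub>R t + (v \<bullet> n) *\<^sub>R n + (v \<bullet> cross3 t n) *\<^sub>R cross3 t n"
proof -
  let ?b = "cross3 t n"
  have bb: "?b \<bullet> ?b = 1"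
    using assms by (simp add: dot_cross)
  have bt: "cross3 ?b t = n" and bn: "cross3 ?b n = - t"
    using assms Lagrange[of t t n] Lagrange[of n t n] cross_skew[of ?b t] cross_skew[of ?b n]
    by (simp_all add: inner_commute)
  have "cross3 ?b (cross3 v ?b) = v - (v \<bullet> ?b) *\<^sub>R ?b"
    using bb Lagrange[of ?b v ?b] by (simp add: inner_commute)
  moreover have "cross3 ?b (cross3 v ?b) = (v \<bullet> n) *\<^sub>R n + (v \<bullet> t) *\<^sub>R t"
    by (simp add: Lagrange[of v t n] bt bn Cross3.right_diff_distrib cross_mult_right)
  ultimately show ?thesis
    by (simp add: algebra_simps)
qed

section \<open>The frame of a Frenet curve\<close>

lemma curvature_pos:
  assumes "frenet_curve I \<alpha>" "s \<in> I"
  shows "curvature \<alpha> s > 0"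
  using assms by (simp add: frenet_curve_def curvature_def)

lemma tangent_has_derivative:
  assumes "frenet_curve I \<alpha>" "s \<in> I"
  shows "(tangent \<alpha> has_vector_derivative curvature \<alpha> s *\<^sub>R normal \<alpha> s) (at s)"
  using smooth_on_has_curve_deriv[of I \<alpha> s 1] assms curvature_pos[OF assms]
  by (simp add: frenet_curve_def tangent_def normal_def)

lemma frame_orthonormal:
  assumes "open I" "frenet_curve I \<alpha>" "s \<in> I"
  shows "tangent \<alpha> s \<bullet> tangent \<alpha> s = 1" "normal \<alpha> s \<bullet> normal \<alpha> s = 1"
    "tangent \<alpha> s \<bullet> normal \<alpha> s = 0"
    "binormal \<alpha> s \<bullet> binormal \<alpha> s = 1"
    "tangent \<alpha> s \<bullet> binormal \<alpha> s = 0" "normal \<alpha> s \<bullet> binormal \<alpha> s = 0"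
proof -
  have TT: "tangent \<alpha> t \<bullet> tangent \<alpha> t = 1" if "t \<in> I" for t
    using assms(2) that by (simp add: frenet_curve_def tangent_def dot_square_norm)
  then show T: "tangent \<alpha> s \<bullet> tangent \<alpha> s = 1"
    using assms by blast
  have "norm (normal \<alpha> s) = 1"
    using curvature_pos[OF assms(2,3)] by (simp add: normal_def) (simp add: curvature_def)
  then show N: "normal \<alpha> s \<bullet> normal \<alpha> s = 1"
    by (simp add: dot_square_norm)
  show TN: "tangent \<alpha> s \<bullet> normal \<alpha> s = 0"
    using constant_inner_product_rule[OF assms(1,3) TT
        tangent_has_derivative[OF assms(2,3)] tangent_has_derivative[OF assms(2,3)]]
      curvature_pos[OF assms(2,3)]
    by (simp add: inner_commute)
  show "binormal \<alpha> s \<bullet> binormal \<alpha> s = 1"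
    using T N TN by (simp add: binormal_def dot_cross)
  show "tangent \<alpha> s \<bullet> binormal \<alpha> s = 0" "normal \<alpha> s \<bullet> binormal \<alpha> s = 0"
    by (simp_all add: binormal_def dot_cross_self)
qed

lemma frame_expansion:
  assumes "open I" "frenet_curve I \<alpha>" "s \<in> I"
  shows "v = (v \<bullet> tangent \<alpha> s) *\<^sub>R tangent \<alpha> s + (v \<bullet> normal \<alpha> s) *\<^sub>R normal \<alpha> s
    + (v \<bullet> binormal \<alpha> s) *\<^sub>R binormal \<alpha> s"
  unfolding binormal_def using orthonormal_pair_expansion frame_orthonormal(1-3)[OF assms] .

text \<open>Each derivative is expanded in the frame; its components follow from the constancy of the inner
  products of the frame vectors. The torsion enters through \<open>B' \<bullet> N = - \<tau>\<close>, and \<open>N \<bullet> B = 0\<close> turns this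
  into \<open>N' \<bullet> B = \<tau>\<close>.\<close>

lemma frenet_equations:
  assumes "open I" "frenet_curve I \<alpha>" "s \<in> I"
  shows "(normal \<alpha> has_vector_derivative
      - curvature \<alpha> s *\<^sub>R tangent \<alpha> s + torsion \<alpha> s *\<^sub>R binormal \<alpha> s) (at s)" (is ?normal)
    and "(binormal \<alpha> has_vector_derivative - torsion \<alpha> s *\<^sub>R normal \<alpha> s) (at s)" (is ?binormal)
proof -
  note T' = tangent_has_derivative[OF assms(2,3)]
  note orthonormal = frame_orthonormal[OF assms(1,2)]
  note rule = constant_inner_product_rule[OF assms(1,3)]
  have smooth: "smooth_on I \<alpha>"
    using assms(2) by (simp add: frenet_curve_def)
  have "curve_deriv (curve_deriv \<alpha>) differentiable (at s)"
    using smooth assms(3) unfolding smooth_on_def by (metis funpow_0 funpow_simps_right(2) comp_apply)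
  \<comment> \<open>The norm is not differentiable at zero: this is where the curvature has to be nonzero.\<close>
  moreover have "curve_deriv (curve_deriv \<alpha>) s \<noteq> 0"
    using curvature_pos[OF assms(2,3)] by (auto simp: curvature_def)
  moreover from calculation have "(\<lambda>t. norm (curve_deriv (curve_deriv \<alpha>) t)) differentiable (at s)"
    by (intro differentiable_compose[OF differentiable_norm_at])
  ultimately have "(\<lambda>t. curve_deriv (curve_deriv \<alpha>) t /\<^sub>R norm (curve_deriv (curve_deriv \<alpha>) t))
      differentiable (at s)"
    by simp
  then have "normal \<alpha> differentiable (at s)"
    by (simp add: normal_def[abs_def] curvature_def)
  then obtain N' where N': "(normal \<alpha> has_vector_derivative N') (at s)"
    by (auto simp: vector_derivative_works)
  have "(binormal \<alpha> has_vector_derivative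
      cross3 (tangent \<alpha> s) N' + cross3 (curvature \<alpha> s *\<^sub>R normal \<alpha> s) (normal \<alpha> s)) (at s)"
    unfolding binormal_def[abs_def]
    by (intro bounded_bilinear.has_vector_derivative[OF bilinear_conv_bounded_bilinear[THEN iffD1, OF bilinear_cross]] T' N')
  then obtain B' where B': "(binormal \<alpha> has_vector_derivative B') (at s)"
    by blast
  have \<tau>: "torsion \<alpha> s = - (B' \<bullet> normal \<alpha> s)"
    using B' by (simp add: torsion_def curve_deriv_def vector_derivative_at)
  have "N' \<bullet> normal \<alpha> s = 0"
    using rule[OF orthonormal(2) N' N'] by (simp add: inner_commute)
  moreover have "N' \<bullet> tangent \<alpha> s = - curvature \<alpha> s"
    using rule[OF orthonormal(3) T' N'] orthonormal(2)[OF assms(3)] by (simp add: inner_commute)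
  moreover have "N' \<bullet> binormal \<alpha> s = torsion \<alpha> s"
    using rule[OF orthonormal(6) N' B'] \<tau> by (simp add: inner_commute)
  ultimately show ?normal
    using N' frame_expansion[OF assms, of N'] by simp
  have "B' \<bullet> binormal \<alpha> s = 0"
    using rule[OF orthonormal(4) B' B'] by (simp add: inner_commute)
  moreover have "B' \<bullet> tangent \<alpha> s = 0"
    using rule[OF orthonormal(5) T' B'] orthonormal(6)[OF assms(3)] by (simp add: inner_commute)
  ultimately show ?binormal
    using B' frame_expansion[OF assms, of B'] \<tau> by simp
qed

section \<open>The tangent of an evolute in the frame of the curve\<close>

text \<open>The sign of the first coefficient is forced: \<open>\<beta>'\<close> points to the side of \<open>- N\<close>, since \<open>\<beta>''\<close> is a
  positive multiple of \<open>T\<close> while \<open>T'\<close> is a positive multiple of \<open>N\<close>. For the torsion, the term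
  \<open>\<beta>'' \<times> T\<close> of \<open>(\<beta>' \<times> T)'\<close> vanishes and \<open>(\<beta>' \<times> N) \<bullet> T = - \<beta>' \<bullet> B\<close>.\<close>

lemma evolute_coefficients:
  assumes "open I" "frenet_curve I \<alpha>" "evolute I \<alpha> \<beta>"
    and b_def: "b = (\<lambda>t. tangent \<beta> t \<bullet> normal \<alpha> t)"
    and c_def: "c = (\<lambda>t. tangent \<beta> t \<bullet> binormal \<alpha> t)"
    and s: "s \<in> I"
  shows "tangent \<beta> s = b s *\<^sub>R normal \<alpha> s + c s *\<^sub>R binormal \<alpha> s"
    and "(b s)\<^sup>2 + (c s)\<^sup>2 = 1"
    and "(b has_real_derivative torsion \<alpha> s * c s) (at s)"
    and "(c has_real_derivative - torsion \<alpha> s * b s) (at s)"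
    and "curvature \<beta> s = - curvature \<alpha> s * b s"
    and "torsion \<beta> s = curvature \<alpha> s * c s"
    and "b s < 0"
proof -
  have \<beta>: "frenet_curve I \<beta>"
    and orth: "\<And>t. t \<in> I \<Longrightarrow> tangent \<beta> t \<bullet> tangent \<alpha> t = 0"
    and N\<beta>: "\<And>t. t \<in> I \<Longrightarrow> normal \<beta> t = tangent \<alpha> t"
    using assms(3) by (auto simp: evolute_def)
  note frame = frame_orthonormal[OF assms(1,2) s]
  note T' = tangent_has_derivative[OF assms(2) s]
  note N' = frenet_equations(1)[OF assms(1,2) s]
  note B' = frenet_equations(2)[OF assms(1,2) s]
  have T\<beta>': "(tangent \<beta> has_vector_derivative curvature \<beta> s *\<^sub>R tangent \<alpha> s) (at s)"
    using tangent_has_derivative[OF \<beta> s] N\<beta>[OF s] by simp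
  show T\<beta>: "tangent \<beta> s = b s *\<^sub>R normal \<alpha> s + c s *\<^sub>R binormal \<alpha> s"
    using frame_expansion[OF assms(1,2) s, of "tangent \<beta> s"] orth[OF s]
    by (simp add: b_def c_def)
  have "tangent \<beta> s \<bullet> tangent \<beta> s = (b s)\<^sup>2 + (c s)\<^sup>2"
    by (subst (2) T\<beta>) (simp add: inner_add_right b_def c_def power2_eq_square)
  then show "(b s)\<^sup>2 + (c s)\<^sup>2 = 1"
    using frame_orthonormal(1)[OF assms(1) \<beta> s] by simp
  show "(b has_real_derivative torsion \<alpha> s * c s) (at s)"
    using bounded_bilinear.has_vector_derivative[OF bounded_bilinear_inner T\<beta>' N']
      orth[OF s] frame(3)
    by (simp add: b_def c_def has_real_derivative_iff_has_vector_derivative inner_diff_right)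
  show "(c has_real_derivative - torsion \<alpha> s * b s) (at s)"
    using bounded_bilinear.has_vector_derivative[OF bounded_bilinear_inner T\<beta>' B'] frame(5)
    by (simp add: b_def c_def has_real_derivative_iff_has_vector_derivative)
  show curvature: "curvature \<beta> s = - curvature \<alpha> s * b s"
    using constant_inner_product_rule[OF assms(1) s orth T\<beta>' T'] frame(1)
    by (simp add: b_def)
  then show "b s < 0"
    using curvature_pos[OF assms(2) s] curvature_pos[OF \<beta> s]
    by (simp add: mult_less_0_iff)
  have "((\<lambda>t. cross3 (tangent \<beta> t) (tangent \<alpha> t)) has_vector_derivative
      cross3 (tangent \<beta> s) (curvature \<alpha> s *\<^sub>R normal \<alpha> s)
      + cross3 (curvature \<beta> s *\<^sub>R tangent \<alpha> s) (tangent \<alpha> s)) (at s)"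
    by (intro bounded_bilinear.has_vector_derivative[OF bilinear_conv_bounded_bilinear[THEN iffD1, OF bilinear_cross]] T\<beta>' T')
  then have "((\<lambda>t. cross3 (tangent \<beta> t) (tangent \<alpha> t)) has_vector_derivative
      curvature \<alpha> s *\<^sub>R cross3 (tangent \<beta> s) (normal \<alpha> s)) (at s)"
    by (simp add: cross_mult_left cross_mult_right)
  then have "(binormal \<beta> has_vector_derivative
      curvature \<alpha> s *\<^sub>R cross3 (tangent \<beta> s) (normal \<alpha> s)) (at s)"
    by (rule has_vector_derivative_transform_within_open[OF _ assms(1) s])
      (simp add: binormal_def N\<beta>)
  then have "torsion \<beta> s = - curvature \<alpha> s * (cross3 (tangent \<beta> s) (normal \<alpha> s) \<bullet> tangent \<alpha> s)"
    using N\<beta>[OF s] by (simp add: torsion_def curve_deriv_def vector_derivative_at)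
  also have "cross3 (tangent \<beta> s) (normal \<alpha> s) \<bullet> tangent \<alpha> s = - c s"
    unfolding c_def binormal_def
    by (metis cross_skew cross_triple inner_commute inner_minus_right)
  finally show "torsion \<beta> s = curvature \<alpha> s * c s"
    by simp
qed

section \<open>Angle, curvature and torsion of an evolute\<close>

text \<open>On the half circle where the sine is negative, \<open>- arccos\<close> inverts the cosine and is smooth.\<close>

lemma evolute_angle_exists:
  assumes "open I" "frenet_curve I \<alpha>" "evolute I \<alpha> \<beta>"
  shows "\<exists>\<theta>. evolute_angle I \<alpha> \<beta> \<theta>"
proof -
  define b where "b = (\<lambda>t. tangent \<beta> t \<bullet> normal \<alpha> t)"
  define c where "c = (\<lambda>t. tangent \<beta> t \<bullet> binormal \<alpha> t)"
  note coefficients = evolute_coefficients[OF assms b_def c_def]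
  have "((\<lambda>t. - arccos (c t)) has_real_derivative torsion \<alpha> s) (at s) \<and>
      curve_deriv \<beta> s = sin (- arccos (c s)) *\<^sub>R normal \<alpha> s + cos (- arccos (c s)) *\<^sub>R binormal \<alpha> s"
    if s: "s \<in> I" for s
  proof
    note circle = coefficients(2)[OF s] and neg = coefficients(7)[OF s]
    have "(c s)\<^sup>2 < 1"
      using circle neg by (smt (verit) zero_less_power2)
    then have c: "- 1 < c s" "c s < 1"
      by (simp_all add: abs_square_less_1 abs_less_iff)
    have "1 - (c s)\<^sup>2 = (b s)\<^sup>2"
      using circle by linarith
    then have root: "sqrt (1 - (c s)\<^sup>2) = - b s"
      using neg by simp
    show "curve_deriv \<beta> s = sin (- arccos (c s)) *\<^sub>R normal \<alpha> s + cos (- arccos (c s)) *\<^sub>R binormal \<alpha> s"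
      using coefficients(1)[OF s] c root by (simp add: tangent_def sin_arccos)
    have "((\<lambda>t. - arccos (c t)) has_real_derivative
        - (inverse (- sqrt (1 - (c s)\<^sup>2)) * (- torsion \<alpha> s * b s))) (at s)"
      by (intro DERIV_minus DERIV_chain2[OF DERIV_arccos] coefficients(4)[OF s] c)
    then show "((\<lambda>t. - arccos (c t)) has_real_derivative torsion \<alpha> s) (at s)"
      using neg by (simp add: root field_simps)
  qed
  then show ?thesis
    unfolding evolute_angle_def by blast
qed

theorem theorem3p5:
  fixes I :: "real set" and \<alpha> \<beta> :: "real \<Rightarrow> real^3"
  assumes "open I" and "is_interval I" and "I \<noteq> {}"
    and "frenet_curve I \<alpha>"
    and "evolute_direction_curve I \<alpha> \<beta>"
  shows "(\<exists>\<theta>. evolute_angle I \<alpha> \<beta> \<theta>) \<and>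
    (\<forall>\<theta>. evolute_angle I \<alpha> \<beta> \<theta> \<longrightarrow>
      (\<forall>s\<in>I. curvature \<beta> s = curvature \<alpha> s * \<bar>sin (\<theta> s)\<bar> \<and>
             torsion \<beta> s = curvature \<alpha> s * cos (\<theta> s))) \<and>
    (\<forall>s\<in>I. curvature \<alpha> s = sqrt ((curvature \<beta> s)\<^sup>2 + (torsion \<beta> s)\<^sup>2) \<and>
           (\<lambda>u. torsion \<beta> u / curvature \<beta> u) differentiable (at s) \<and>
           torsion \<alpha> s = (curvature \<beta> s)\<^sup>2 / ((curvature \<beta> s)\<^sup>2 + (torsion \<beta> s)\<^sup>2)
             * deriv (\<lambda>u. torsion \<beta> u / curvature \<beta> u) s)"
proof -
  have evolute: "evolute I \<alpha> \<beta>"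
    using assms(5) by (simp add: evolute_direction_curve_def)
  define b where "b = (\<lambda>t. tangent \<beta> t \<bullet> normal \<alpha> t)"
  define c where "c = (\<lambda>t. tangent \<beta> t \<bullet> binormal \<alpha> t)"
  note coefficients = evolute_coefficients[OF assms(1,4) evolute b_def c_def]
  have "curvature \<beta> s = curvature \<alpha> s * \<bar>sin (\<theta> s)\<bar> \<and> torsion \<beta> s = curvature \<alpha> s * cos (\<theta> s)"
    if "evolute_angle I \<alpha> \<beta> \<theta>" and s: "s \<in> I" for \<theta> s
  proof -
    have "tangent \<beta> s = sin (\<theta> s) *\<^sub>R normal \<alpha> s + cos (\<theta> s) *\<^sub>R binormal \<alpha> s"
      using that by (simp add: evolute_angle_def tangent_def)
    then have "b s = sin (\<theta> s)" "c s = cos (\<theta> s)"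
      using frame_orthonormal[OF assms(1,4) s]
      by (simp_all add: b_def c_def inner_add_right inner_commute)
    then show ?thesis
      using coefficients(5-7)[OF s] by simp
  qed
  moreover have "curvature \<alpha> s = sqrt ((curvature \<beta> s)\<^sup>2 + (torsion \<beta> s)\<^sup>2) \<and>
      (\<lambda>u. torsion \<beta> u / curvature \<beta> u) differentiable (at s) \<and>
      torsion \<alpha> s = (curvature \<beta> s)\<^sup>2 / ((curvature \<beta> s)\<^sup>2 + (torsion \<beta> s)\<^sup>2)
        * deriv (\<lambda>u. torsion \<beta> u / curvature \<beta> u) s"
    if s: "s \<in> I" for s
  proof -
    note pos = curvature_pos[OF assms(4)] and neg = coefficients(7)
    have "(curvature \<beta> s)\<^sup>2 + (torsion \<beta> s)\<^sup>2 = (curvature \<alpha> s)\<^sup>2 * ((b s)\<^sup>2 + (c s)\<^sup>2)"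
      using coefficients(5,6)[OF s] by (simp add: algebra_simps)
    then have squares: "(curvature \<beta> s)\<^sup>2 + (torsion \<beta> s)\<^sup>2 = (curvature \<alpha> s)\<^sup>2"
      using coefficients(2)[OF s] by simp
    have "((\<lambda>t. - (c t / b t)) has_real_derivative
        - ((- torsion \<alpha> s * b s * b s - c s * (torsion \<alpha> s * c s)) / (b s * b s))) (at s)"
      using neg[OF s] by (intro DERIV_minus DERIV_divide coefficients(3,4) s) simp
    also have "- ((- torsion \<alpha> s * b s * b s - c s * (torsion \<alpha> s * c s)) / (b s * b s))
        = torsion \<alpha> s * ((b s)\<^sup>2 + (c s)\<^sup>2) / (b s)\<^sup>2"
      using neg[OF s] by (simp add: field_simps power2_eq_square)
    finally have "((\<lambda>t. - (c t / b t)) has_real_derivative torsion \<alpha> s / (b s)\<^sup>2) (at s)"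
      using coefficients(2)[OF s] by simp
    then have quotient:
      "((\<lambda>t. torsion \<beta> t / curvature \<beta> t) has_real_derivative torsion \<alpha> s / (b s)\<^sup>2) (at s)"
    proof (rule has_field_derivative_transform_within_open[OF _ assms(1) s])
      show "- (c t / b t) = torsion \<beta> t / curvature \<beta> t" if "t \<in> I" for t
        using coefficients(5,6)[OF that] pos[OF that] by simp
    qed
    have "(curvature \<beta> s)\<^sup>2 / (curvature \<alpha> s)\<^sup>2 = (b s)\<^sup>2"
      using coefficients(5)[OF s] pos[OF s] by (simp add: power_mult_distrib)
    then show ?thesis
      using squares pos[OF s] neg[OF s] DERIV_imp_deriv[OF quotient]
        differentiableI[OF has_field_derivative_imp_has_derivative[OF quotient]]
      by simp
  qed
  ultimately show ?thesis
    using evolute_angle_exists[OF assms(1,4) evolute] by blast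
qed

end
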